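(* For every $n \ge 8$, every CNF encoding of $\mathsf{AtMostOne}(x_1,\dots,x_n)$ has at least $2n + \sqrt{n+1} - 2$ clauses.
   Context: $\mathsf{AtMostOne}(x_1,\dots,x_n)$ is true iff at most one of $x_1,\dots,x_n$ is true. A CNF formula is a set of clauses; its size is its number of clauses. For a partial assignment $\tau$ and CNF $\varphi$, $\varphi|_\tau$ is obtained by deleting every clause satisfied by $\tau$ and deleting from the remaining clauses every literal falsified by $\tau$. A CNF $\varphi$ over variables $X\sqcup Y$, $X=(x_1,\dots,x_n)$, encodes $f$ if for every assignment $\tau$ of $X$, $f(\tau(x_1),\dots,\tau(x_n))=\top$ iff $\varphi|_\tau$ is satisfiable; $Y$ is an arbitrary set of auxiliary variables. No propagation property is assumed. *)

theory Defs
  imports Complex_Main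
begin

datatype 'v literal = Pos 'v | Neg 'v

primrec var_of :: "'v literal \<Rightarrow> 'v" where
  "var_of (Pos v) = v"
| "var_of (Neg v) = v"

type_synonym 'v clause = "'v literal set"
type_synonym 'v cnf = "'v clause set"

definition is_cnf_over :: "'v set \<Rightarrow> 'v cnf \<Rightarrow> bool" where
  "is_cnf_over V \<phi> \<longleftrightarrow>
     finite \<phi> \<and> (\<forall>C\<in>\<phi>. finite C \<and> var_of ` C \<subseteq> V)"

definition cnf_size :: "'v cnf \<Rightarrow> nat" where
  "cnf_size \<phi> = card \<phi>"

text \<open>A partial assignment is a map \<open>\<tau> :: 'v \<rightharpoonup> bool\<close>; it neither satisfies nor
  falsifies a literal whose variable lies outside its domain.\<close>

primrec lit_satisfied :: "('v \<rightharpoonup> bool) \<Rightarrow> 'v literal \<Rightarrow> bool" where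
  "lit_satisfied \<tau> (Pos v) \<longleftrightarrow> \<tau> v = Some True"
| "lit_satisfied \<tau> (Neg v) \<longleftrightarrow> \<tau> v = Some False"

primrec lit_falsified :: "('v \<rightharpoonup> bool) \<Rightarrow> 'v literal \<Rightarrow> bool" where
  "lit_falsified \<tau> (Pos v) \<longleftrightarrow> \<tau> v = Some False"
| "lit_falsified \<tau> (Neg v) \<longleftrightarrow> \<tau> v = Some True"

definition clause_satisfied :: "('v \<rightharpoonup> bool) \<Rightarrow> 'v clause \<Rightarrow> bool" where
  "clause_satisfied \<tau> C \<longleftrightarrow> (\<exists>l\<in>C. lit_satisfied \<tau> l)"

definition restrict_cnf :: "'v cnf \<Rightarrow> ('v \<rightharpoonup> bool) \<Rightarrow> 'v cnf" where
  "restrict_cnf \<phi> \<tau> =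
     (\<lambda>C. {l \<in> C. \<not> lit_falsified \<tau> l}) ` {C \<in> \<phi>. \<not> clause_satisfied \<tau> C}"

primrec lit_true :: "('v \<Rightarrow> bool) \<Rightarrow> 'v literal \<Rightarrow> bool" where
  "lit_true \<sigma> (Pos v) \<longleftrightarrow> \<sigma> v"
| "lit_true \<sigma> (Neg v) \<longleftrightarrow> \<not> \<sigma> v"

definition satisfiable :: "'v cnf \<Rightarrow> bool" where
  "satisfiable \<phi> \<longleftrightarrow> (\<exists>\<sigma>. \<forall>C\<in>\<phi>. \<exists>l\<in>C. lit_true \<sigma> l)"

text \<open>The input variables \<open>X = (x\<^sub>1, \<dots>, x\<^sub>n)\<close> form a list of distinct variables, and a Boolean
  function of arity \<open>n\<close> is a predicate on Boolean lists, applied only to lists of length \<open>n\<close>.\<close>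

definition encodes :: "'v list \<Rightarrow> 'v set \<Rightarrow> 'v cnf \<Rightarrow> (bool list \<Rightarrow> bool) \<Rightarrow> bool" where
  "encodes X Y \<phi> f \<longleftrightarrow>
     distinct X \<and> set X \<inter> Y = {} \<and> is_cnf_over (set X \<union> Y) \<phi> \<and>
     (\<forall>\<tau>. dom \<tau> = set X \<longrightarrow>
        (f (map (\<lambda>x. the (\<tau> x)) X) \<longleftrightarrow> satisfiable (restrict_cnf \<phi> \<tau>)))"

definition AtMostOne :: "bool list \<Rightarrow> bool" where
  "AtMostOne bs \<longleftrightarrow> card {i. i < length bs \<and> bs ! i} \<le> 1"

end

theory Submission imports Defs begin

text \<open>
  Induct on the number of clauses. Let \<open>x\<close> be an input.
  If \<open>x\<close> occurs negatively in at most one clause, or all such clauses share a literal that is true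
  in a model where only \<open>x\<close> is true, then \<open>x\<close> can be replaced by that literal,
  which saves a clause. If \<open>x\<close> occurs negatively in at least three clauses, setting it to false loses one
  input and three clauses; if it occurs in two but shares one with another input \<open>y\<close>, then
  after setting \<open>x\<close> to false the first case applies to \<open>y\<close>, with the same gain.

  Otherwise there are \<open>2 * n\<close> clauses with negative inputs and a set \<open>R\<close> of \<open>r\<close> others, and
  every input \<open>i\<close> implies two literals \<open>l i\<close> and \<open>m i\<close>. View these pairs as the edges of a
  graph on literals. The edges at a vertex of degree \<open>d\<close> turn \<open>R\<close> into an encoding
  with \<open>d\<close> inputs, so \<open>d \<le> 2\<close> or \<open>2 * d \<le> r + 3\<close> by induction. A model where only
  input \<open>k\<close> is true makes an endpoint of every other edge false. Set aside the at most \<open>2 * d\<close>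
  edges at the negations of \<open>l k\<close> and \<open>m k\<close>, and choose the model with as many true endpoints
  of the remaining edges as possible. The negation of a false endpoint is either the only true
  literal of some clause of \<open>R\<close>, which happens for at most \<open>r\<close> endpoints, or the endpoint can be
  flipped, and then maximality bounds the number of edges joining two flippable endpoints by half
  the number of edges at the others. This gives \<open>2 * n \<le> 2 + 4 * d + 3 * r * d\<close>, hence
  \<open>r + 2 \<ge> sqrt (n + 1)\<close> or \<open>n \<le> r + 7\<close>.
\<close>

section \<open>Literals, negation and changes of an assignment\<close>

primrec neg :: "'v literal \<Rightarrow> 'v literal" where
  "neg (Pos v) = Neg v"
| "neg (Neg v) = Pos v"

lemma neg_neg [simp]: "neg (neg q) = q"
  by (cases q) auto

lemma neg_neq [simp]: "neg q \<noteq> q" "q \<noteq> neg q"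
  by (cases q; simp)+

lemma neg_eq_iff [simp]: "neg p = neg q \<longleftrightarrow> p = q"
  by (metis neg_neg)

lemma neg_eq_flip: "neg p = q \<longleftrightarrow> p = neg q"
  by (metis neg_neg)

lemma lit_true_neg [simp]: "lit_true \<sigma> (neg q) \<longleftrightarrow> \<not> lit_true \<sigma> q"
  by (cases q) auto

text \<open>No variable occurs in \<open>A\<close> with both signs, so the values \<open>g\<close>
  can be prescribed on all of \<open>A\<close> independently.\<close>

lemma override_assignment:
  assumes "\<And>q. q \<in> A \<Longrightarrow> neg q \<notin> A"
  obtains \<tau> where "\<And>q. q \<in> A \<Longrightarrow> lit_true \<tau> q \<longleftrightarrow> g q"
    and "\<And>q. q \<notin> A \<Longrightarrow> neg q \<notin> A \<Longrightarrow> lit_true \<tau> q \<longleftrightarrow> lit_true \<sigma> q"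
proof
  let ?\<tau> = "\<lambda>v. if Pos v \<in> A then g (Pos v) else if Neg v \<in> A then \<not> g (Neg v) else \<sigma> v"
  show "lit_true ?\<tau> q \<longleftrightarrow> g q" if "q \<in> A" for q
    using that assms[OF that] by (cases q) auto
  show "lit_true ?\<tau> q \<longleftrightarrow> lit_true \<sigma> q" if "q \<notin> A" "neg q \<notin> A" for q
    using that by (cases q) auto
qed

lemma assign_literal:
  obtains \<tau> where "lit_true \<tau> p \<longleftrightarrow> b"
    and "\<And>q. q \<noteq> p \<Longrightarrow> q \<noteq> neg p \<Longrightarrow> lit_true \<tau> q \<longleftrightarrow> lit_true \<sigma> q"
proof -
  obtain \<tau> where "\<And>q. q \<in> {p} \<Longrightarrow> lit_true \<tau> q \<longleftrightarrow> b"
    "\<And>q. q \<notin> {p} \<Longrightarrow> neg q \<notin> {p} \<Longrightarrow> lit_true \<tau> q \<longleftrightarrow> lit_true \<sigma> q"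
    by (rule override_assignment[of "{p}" "\<lambda>_. b" \<sigma>]) auto
  then show ?thesis
    by (intro that[of \<tau>]) (simp, metis neg_neg singletonD)
qed

section \<open>At-most-one encodings whose inputs are literals\<close>

definition models :: "('v \<Rightarrow> bool) \<Rightarrow> 'v cnf \<Rightarrow> bool" where
  "models \<sigma> \<phi> \<longleftrightarrow> (\<forall>C\<in>\<phi>. \<exists>q\<in>C. lit_true \<sigma> q)"

definition one_hot :: "'v literal set \<Rightarrow> 'v literal \<Rightarrow> ('v \<Rightarrow> bool) \<Rightarrow> bool" where
  "one_hot L p \<sigma> \<longleftrightarrow> (\<forall>q\<in>L. lit_true \<sigma> q \<longleftrightarrow> q = p)"

text \<open>The inputs are literals rather than variables, and nothing is required when all inputs are
  false; both relaxations are needed for the class to be closed under substituting an auxiliary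
  literal for an input.\<close>

definition amo_encoding :: "'v literal set \<Rightarrow> 'v cnf \<Rightarrow> bool" where
  "amo_encoding L \<phi> \<longleftrightarrow> finite \<phi> \<and>
     (\<forall>p\<in>L. \<exists>\<sigma>. models \<sigma> \<phi> \<and> one_hot L p \<sigma>) \<and>
     (\<forall>\<sigma>. models \<sigma> \<phi> \<longrightarrow> (\<forall>p\<in>L. \<forall>q\<in>L. lit_true \<sigma> p \<longrightarrow> lit_true \<sigma> q \<longrightarrow> p = q))"

lemma amo_encoding_finite: "amo_encoding L \<phi> \<Longrightarrow> finite \<phi>"
  by (simp add: amo_encoding_def)

lemma amo_encoding_one_hot:
  assumes "amo_encoding L \<phi>" "p \<in> L"
  obtains \<sigma> where "models \<sigma> \<phi>" "one_hot L p \<sigma>"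
  using assms by (auto simp: amo_encoding_def)

lemma amo_encoding_unique:
  "\<lbrakk>amo_encoding L \<phi>; models \<sigma> \<phi>; p \<in> L; q \<in> L; lit_true \<sigma> p; lit_true \<sigma> q\<rbrakk> \<Longrightarrow> p = q"
  by (auto simp: amo_encoding_def)

lemma ex_third:
  assumes "card L \<ge> 3"
  obtains r where "r \<in> L" "r \<noteq> p" "r \<noteq> q"
proof -
  have "\<not> L \<subseteq> {p, q}"
  proof
    assume "L \<subseteq> {p, q}"
    then have "card L \<le> card {p, q}" by (rule card_mono[rotated]) auto
    also have "\<dots> \<le> 2" by (simp add: card_insert_if)
    finally show False using assms by simp
  qed
  then show ?thesis using that by auto
qed

text \<open>If both signs were inputs, a model in which only a third input is true would make both
  of them false.\<close>

lemma amo_encoding_consistent: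
  assumes "amo_encoding L \<phi>" "card L \<ge> 3" "p \<in> L"
  shows "neg p \<notin> L"
proof
  assume "neg p \<in> L"
  obtain r where r: "r \<in> L" "r \<noteq> p" "r \<noteq> neg p"
    by (rule ex_third[OF assms(2)])
  obtain \<sigma> where "one_hot L r \<sigma>"
    using amo_encoding_one_hot[OF assms(1) r(1)] by blast
  then have "\<not> lit_true \<sigma> p" "\<not> lit_true \<sigma> (neg p)"
    using r assms(3) \<open>neg p \<in> L\<close> unfolding one_hot_def by metis+
  then show False by simp
qed

section \<open>Reductions that save clauses\<close>

abbreviation neg_occ :: "'v cnf \<Rightarrow> 'v literal \<Rightarrow> 'v cnf" where
  "neg_occ \<phi> p \<equiv> {C \<in> \<phi>. neg p \<in> C}"

lemma remove_tautology:
  assumes "amo_encoding L \<phi>" "C \<in> \<phi>" "p \<in> C" "neg p \<in> C"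
  shows "\<exists>\<phi>'. amo_encoding L \<phi>' \<and> card \<phi>' < card \<phi>"
proof -
  have "models \<sigma> \<phi> \<longleftrightarrow> models \<sigma> (\<phi> - {C})" for \<sigma>
    using assms(3,4) unfolding models_def
    by (metis DiffD1 DiffI empty_iff insert_iff lit_true_neg)
  then have "amo_encoding L (\<phi> - {C})"
    using assms(1) by (simp add: amo_encoding_def)
  moreover have "card (\<phi> - {C}) < card \<phi>"
    using assms(2) amo_encoding_finite[OF assms(1)] by (rule card_Diff1_less[rotated])
  ultimately show ?thesis by blast
qed

text \<open>The literal \<open>a\<close> already behaves like an input in the place of
  \<open>p\<close>: it is true in the model \<open>s\<close> belonging to \<open>p\<close> and false
  in all models belonging to other inputs. Replacing \<open>p\<close> by \<open>a\<close> therefore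
  keeps the number of inputs and makes every clause with \<open>neg p\<close> redundant.\<close>

lemma substitute_common_literal:
  fixes L :: "'v literal set"
  assumes enc: "amo_encoding L \<phi>" and L3: "card L \<ge> 3" and p: "p \<in> L"
    and occ: "neg_occ \<phi> p \<noteq> {}"
    and a: "\<And>C. C \<in> neg_occ \<phi> p \<Longrightarrow> a \<in> C" "a \<noteq> p" "a \<noteq> neg p"
    and s: "models s \<phi>" "one_hot L p s" "lit_true s a"
  shows "\<exists>(L' :: 'v literal set) \<phi>'. amo_encoding L' \<phi>' \<and> card L' = card L \<and> card \<phi>' < card \<phi>"
proof -
  note cons = amo_encoding_consistent[OF enc L3]
  have fin: "finite \<phi>" using enc by (rule amo_encoding_finite)
  \<comment> \<open>If \<open>a\<close> were true, it would satisfy all clauses with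
    \<open>neg p\<close>, so \<open>p\<close> could be switched on next to \<open>k\<close>.\<close>
  have a_false: "\<not> lit_true \<sigma> a" if "k \<in> L" "k \<noteq> p" "models \<sigma> \<phi>" "one_hot L k \<sigma>" for k \<sigma>
  proof
    assume at: "lit_true \<sigma> a"
    obtain \<tau> where \<tau>: "lit_true \<tau> p" "\<And>q. q \<noteq> p \<Longrightarrow> q \<noteq> neg p \<Longrightarrow> lit_true \<tau> q \<longleftrightarrow> lit_true \<sigma> q"
      by (rule assign_literal[of p True \<sigma>]) auto
    have "models \<tau> \<phi>" unfolding models_def
    proof
      fix C assume C: "C \<in> \<phi>"
      show "\<exists>q\<in>C. lit_true \<tau> q"
      proof (cases "neg p \<in> C")
        case True
        then show ?thesis using a C at \<tau>(2) by auto
      next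
        case False
        obtain q where "q \<in> C" "lit_true \<sigma> q"
          using \<open>models \<sigma> \<phi>\<close> C unfolding models_def by auto
        then show ?thesis using False \<tau> by (cases "q = p") auto
      qed
    qed
    moreover have "lit_true \<tau> k"
      using that \<tau>(2)[of k] cons[OF p] unfolding one_hot_def by auto
    ultimately show False
      using amo_encoding_unique[OF enc _ p that(1)] \<tau>(1) that(2) by auto
  qed
  have aL: "a \<notin> L"
    using a_false a(2) by (metis amo_encoding_one_hot enc one_hot_def)
  define L' where "L' = insert a (L - {p})"
  \<comment> \<open>\<open>f\<close> substitutes \<open>a\<close> for \<open>p\<close>. Clauses with
    \<open>neg p\<close> contain \<open>a\<close> and would turn into tautologies, so
    \<open>\<phi>'\<close> drops them.\<close>
  define f where "f C = (if p \<in> C then insert a (C - {p}) else C)" for C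
  define \<phi>' where "\<phi>' = f ` (\<phi> - neg_occ \<phi> p)"
  have finL: "finite L" using L3 by (metis card.infinite not_numeral_le_zero)
  have "card L' = card L"
    unfolding L'_def using aL p finL by (metis DiffD1 card_insert_disjoint card_Suc_Diff1 finite_Diff)
  have "card (\<phi> - neg_occ \<phi> p) < card \<phi>"
    using occ fin by (intro psubset_card_mono) auto
  then have card': "card \<phi>' < card \<phi>"
    unfolding \<phi>'_def using fin by (meson card_image_le finite_Diff le_less_trans)
  have "amo_encoding L' \<phi>'"
    unfolding amo_encoding_def
  proof (intro conjI ballI allI impI)
    show "finite \<phi>'" unfolding \<phi>'_def using fin by simp
  next
    fix k assume k: "k \<in> L'"
    show "\<exists>\<sigma>. models \<sigma> \<phi>' \<and> one_hot L' k \<sigma>"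
    proof (cases "k = a")
      case True
      have "models s \<phi>'"
        using s unfolding models_def \<phi>'_def f_def by auto
      moreover have "one_hot L' k s"
        using s True aL unfolding one_hot_def L'_def by auto
      ultimately show ?thesis by blast
    next
      case False
      then have kL: "k \<in> L" "k \<noteq> p" using k by (auto simp: L'_def)
      obtain \<sigma> where \<sigma>: "models \<sigma> \<phi>" "one_hot L k \<sigma>"
        using amo_encoding_one_hot[OF enc kL(1)] by blast
      have "\<not> lit_true \<sigma> p" using \<sigma> p kL unfolding one_hot_def by auto
      then have "models \<sigma> \<phi>'"
        using \<sigma>(1) unfolding models_def \<phi>'_def f_def by fastforce
      moreover have "one_hot L' k \<sigma>"
        using \<sigma> False a_false[OF kL \<sigma>] unfolding one_hot_def L'_def by auto
      ultimately show ?thesis by blast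
    qed
  next
    fix \<sigma> x y
    assume \<sigma>: "models \<sigma> \<phi>'" and xy: "x \<in> L'" "y \<in> L'" "lit_true \<sigma> x" "lit_true \<sigma> y"
    \<comment> \<open>Giving \<open>p\<close> the value of \<open>a\<close> pulls a model of
      \<open>\<phi>'\<close> back to a model of \<open>\<phi>\<close>.\<close>
    obtain \<tau> where \<tau>: "lit_true \<tau> p \<longleftrightarrow> lit_true \<sigma> a"
      "\<And>q. q \<noteq> p \<Longrightarrow> q \<noteq> neg p \<Longrightarrow> lit_true \<tau> q \<longleftrightarrow> lit_true \<sigma> q"
      by (rule assign_literal[of p "lit_true \<sigma> a" \<sigma>]) auto
    have m: "models \<tau> \<phi>" unfolding models_def
    proof
      fix C assume C: "C \<in> \<phi>"
      show "\<exists>q\<in>C. lit_true \<tau> q"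
      proof (cases "neg p \<in> C")
        case True
        then have "a \<in> C" using a C by auto
        moreover have "lit_true \<tau> a \<or> lit_true \<tau> (neg p)" using \<tau> a by auto
        ultimately show ?thesis using True by blast
      next
        case False
        then have "f C \<in> \<phi>'" using C by (auto simp: \<phi>'_def)
        then obtain q where "q \<in> f C" "lit_true \<sigma> q"
          using \<sigma> unfolding models_def by auto
        then show ?thesis using False \<tau> by (cases "q = p") (auto simp: f_def split: if_splits)
      qed
    qed
    define h where "h q = (if q = a then p else q)" for q
    have h: "h q \<in> L \<and> lit_true \<tau> (h q)" if "q \<in> L'" "lit_true \<sigma> q" for q
      using that \<tau> p cons[OF p] by (auto simp: h_def L'_def)
    have "h x = h y" using amo_encoding_unique[OF enc m] h xy by blast
    then show "x = y" using xy by (auto simp: h_def L'_def split: if_splits)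
  qed
  with card' \<open>card L' = card L\<close> show ?thesis by blast
qed

text \<open>With no negative occurrence, \<open>p\<close> could be switched on in a model of another
  input, which is impossible. With a single clause \<open>D\<close>, either \<open>D\<close> is a
  tautology or the literal that satisfies it in a model of \<open>p\<close> can be substituted for
  \<open>p\<close>.\<close>

lemma few_negative_occurrences:
  fixes L :: "'v literal set"
  assumes enc: "amo_encoding L \<phi>" and L3: "card L \<ge> 3" and p: "p \<in> L"
    and occ: "card (neg_occ \<phi> p) \<le> 1"
  shows "\<exists>(L' :: 'v literal set) \<phi>'. amo_encoding L' \<phi>' \<and> card L' = card L \<and> card \<phi>' < card \<phi>"
proof (cases "neg_occ \<phi> p = {}")
  case True
  obtain k where k: "k \<in> L" "k \<noteq> p" by (rule ex_third[OF L3, of p p])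
  obtain \<sigma> where \<sigma>: "models \<sigma> \<phi>" "one_hot L k \<sigma>"
    using amo_encoding_one_hot[OF enc k(1)] by blast
  obtain \<tau> where \<tau>: "lit_true \<tau> p" "\<And>q. q \<noteq> p \<Longrightarrow> q \<noteq> neg p \<Longrightarrow> lit_true \<tau> q \<longleftrightarrow> lit_true \<sigma> q"
    by (rule assign_literal[of p True \<sigma>]) auto
  have "models \<tau> \<phi>"
    unfolding models_def
  proof
    fix C assume C: "C \<in> \<phi>"
    then obtain q where "q \<in> C" "lit_true \<sigma> q" using \<sigma> unfolding models_def by auto
    then show "\<exists>q\<in>C. lit_true \<tau> q" using True C \<tau> by (cases "q = p") auto
  qed
  moreover have "lit_true \<tau> k"
    using k \<sigma> \<tau>(2)[of k] amo_encoding_consistent[OF enc L3 p] unfolding one_hot_def by auto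
  ultimately show ?thesis
    using amo_encoding_unique[OF enc _ p k(1)] \<tau>(1) k(2) by auto
next
  case False
  have "finite (neg_occ \<phi> p)" using amo_encoding_finite[OF enc] by simp
  then have "card (neg_occ \<phi> p) = 1" using occ False card_gt_0_iff[of "neg_occ \<phi> p"] by linarith
  then obtain D where D: "neg_occ \<phi> p = {D}" by (rule card_1_singletonE)
  then have Din: "D \<in> \<phi>" "neg p \<in> D" by auto
  show ?thesis
  proof (cases "p \<in> D")
    case True
    then show ?thesis using remove_tautology[OF enc Din(1) True Din(2)] by blast
  next
    case pD: False
    obtain s where s: "models s \<phi>" "one_hot L p s"
      using amo_encoding_one_hot[OF enc p] by blast
    then obtain a where a: "a \<in> D" "lit_true s a" using Din unfolding models_def by auto
    have "a \<noteq> p" "a \<noteq> neg p" using a pD s p unfolding one_hot_def by auto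
    then show ?thesis
      using substitute_common_literal[OF enc L3 p False _ _ _ s a(2)] a D by auto
  qed
qed

lemma set_input_false:
  assumes enc: "amo_encoding L \<phi>" and L3: "card L \<ge> 3" and p: "p \<in> L"
  shows "amo_encoding (L - {p}) ((\<lambda>C. C - {p}) ` (\<phi> - neg_occ \<phi> p))"
    (is "amo_encoding ?L ?\<phi>")
  unfolding amo_encoding_def
proof (intro conjI ballI allI impI)
  show "finite ?\<phi>" using amo_encoding_finite[OF enc] by simp
next
  fix k assume k: "k \<in> ?L"
  obtain \<sigma> where \<sigma>: "models \<sigma> \<phi>" "one_hot L k \<sigma>"
    using amo_encoding_one_hot[OF enc, of k] k by blast
  have "\<not> lit_true \<sigma> p" using \<sigma> p k unfolding one_hot_def by auto
  then have "models \<sigma> ?\<phi>" using \<sigma>(1) unfolding models_def by fastforce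
  then show "\<exists>\<sigma>. models \<sigma> ?\<phi> \<and> one_hot ?L k \<sigma>" using \<sigma> unfolding one_hot_def by auto
next
  fix \<sigma> x y
  assume \<sigma>: "models \<sigma> ?\<phi>" and xy: "x \<in> ?L" "y \<in> ?L" "lit_true \<sigma> x" "lit_true \<sigma> y"
  obtain \<tau> where \<tau>: "\<not> lit_true \<tau> p"
    "\<And>q. q \<noteq> p \<Longrightarrow> q \<noteq> neg p \<Longrightarrow> lit_true \<tau> q \<longleftrightarrow> lit_true \<sigma> q"
    by (rule assign_literal[of p False \<sigma>]) auto
  have "models \<tau> \<phi>" unfolding models_def
  proof
    fix C assume C: "C \<in> \<phi>"
    show "\<exists>q\<in>C. lit_true \<tau> q"
    proof (cases "neg p \<in> C")
      case True
      then show ?thesis using \<tau>(1) by (intro bexI[of _ "neg p"]) auto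
    next
      case False
      then have "C - {p} \<in> ?\<phi>" using C by auto
      then obtain q where "q \<in> C - {p}" "lit_true \<sigma> q"
        using \<sigma> unfolding models_def by blast
      then show ?thesis using False \<tau> by auto
    qed
  qed
  moreover have "neg p \<notin> L" by (rule amo_encoding_consistent[OF enc L3 p])
  ultimately show "x = y" using amo_encoding_unique[OF enc, of \<tau> x y] xy \<tau>(2) by auto
qed

text \<open>Only an inequality holds, because clauses that differ just in \<open>p\<close> are
  merged.\<close>

lemma card_set_input_false:
  assumes "finite \<phi>"
  shows "card ((\<lambda>C. C - {p}) ` (\<phi> - neg_occ \<phi> p)) + card (neg_occ \<phi> p) \<le> card \<phi>"
proof -
  have "card (\<phi> - neg_occ \<phi> p) + card (neg_occ \<phi> p) = card \<phi>"
    using assms by (simp add: card_Diff_subset card_mono)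
  then show ?thesis using card_image_le[of "\<phi> - neg_occ \<phi> p" "\<lambda>C. C - {p}"] assms by simp
qed

lemma many_negative_occurrences:
  fixes L :: "'v literal set"
  assumes enc: "amo_encoding L \<phi>" and L3: "card L \<ge> 3" and p: "p \<in> L"
    and occ: "card (neg_occ \<phi> p) \<ge> 3"
  shows "\<exists>(L' :: 'v literal set) \<phi>'. amo_encoding L' \<phi>' \<and> card L' = card L - 1 \<and> card \<phi>' + 3 \<le> card \<phi>"
proof -
  have "finite L" using L3 by (metis card.infinite not_numeral_le_zero)
  then have "card (L - {p}) = card L - 1" using p by simp
  moreover have "card ((\<lambda>C. C - {p}) ` (\<phi> - neg_occ \<phi> p)) + 3 \<le> card \<phi>"
    using card_set_input_false[OF amo_encoding_finite[OF enc], of p] occ by linarith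
  ultimately show ?thesis
    using set_input_false[OF enc L3 p] by blast
qed

text \<open>Setting \<open>p\<close> to false removes two clauses, among them \<open>C\<close>. Then
  \<open>k\<close> has at most one negative occurrence left, and
  \<open>few_negative_occurrences\<close> saves a third clause; four inputs are assumed so that
  three remain for it.\<close>

lemma shared_clause:
  fixes L :: "'v literal set"
  assumes enc: "amo_encoding L \<phi>" and L4: "card L \<ge> 4" and pk: "p \<in> L" "k \<in> L" "p \<noteq> k"
    and occ: "card (neg_occ \<phi> p) = 2" "card (neg_occ \<phi> k) = 2"
    and C: "C \<in> \<phi>" "neg p \<in> C" "neg k \<in> C"
  shows "\<exists>(L' :: 'v literal set) \<phi>'. amo_encoding L' \<phi>' \<and> card L' = card L - 1 \<and> card \<phi>' + 3 \<le> card \<phi>"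
proof -
  let ?\<phi> = "(\<lambda>C. C - {p}) ` (\<phi> - neg_occ \<phi> p)"
  have L3: "card L \<ge> 3" using L4 by simp
  have fin: "finite \<phi>" by (rule amo_encoding_finite[OF enc])
  have "finite L" using L3 by (metis card.infinite not_numeral_le_zero)
  then have cL: "card (L - {p}) = card L - 1" using pk by simp
  have enc': "amo_encoding (L - {p}) ?\<phi>" by (rule set_input_false[OF enc L3 pk(1)])
  have L3': "card (L - {p}) \<ge> 3" and k': "k \<in> L - {p}" using cL L4 pk by auto
  have sub: "neg_occ ?\<phi> k \<subseteq> (\<lambda>C. C - {p}) ` (neg_occ \<phi> k - {C})"
    using C by auto
  have "card (neg_occ ?\<phi> k) \<le> card ((\<lambda>C. C - {p}) ` (neg_occ \<phi> k - {C}))"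
    using fin by (intro card_mono sub) auto
  also have "\<dots> \<le> card (neg_occ \<phi> k - {C})" using fin by (intro card_image_le) auto
  also have "\<dots> = 1" using occ(2) C fin by simp
  finally obtain L' :: "'v literal set" and \<phi>' where "amo_encoding L' \<phi>'" "card L' = card (L - {p})" "card \<phi>' < card ?\<phi>"
    using few_negative_occurrences[OF enc' L3' k'] by blast
  moreover have "card ?\<phi> + 2 \<le> card \<phi>" using card_set_input_false[OF fin, of p] occ(1) by simp
  ultimately show ?thesis using cL by (intro exI[of _ L'] exI[of _ \<phi>']) auto
qed

section \<open>The base case of three inputs\<close>

lemma subset_pair:
  assumes "finite A" "card A \<le> 2"
  shows "\<exists>x y. A \<subseteq> {x, y}"
proof -
  consider "card A = 0" | "card A = 1" | "card A = 2" using assms(2) by linarith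
  then show ?thesis
    using assms(1) by cases (auto simp: card_1_singleton_iff card_2_iff)
qed

text \<open>Each of the six ordered pairs of distinct inputs \<open>y\<close>, \<open>z\<close>
  needs a clause with \<open>neg y\<close> but without \<open>neg z\<close>. One clause serves at
  most two of these pairs, so two clauses are not enough.\<close>

lemma three_inputs:
  assumes enc: "amo_encoding L \<phi>" and L3: "card L = 3"
  shows "card \<phi> \<ge> 3"
proof -
  obtain a b c where L: "L = {a, b, c}" and d: "a \<noteq> b" "a \<noteq> c" "b \<noteq> c"
    using L3 by (metis card_3_iff)
  note cons = amo_encoding_consistent[OF enc]
  \<comment> \<open>Switching on \<open>y\<close> in the model of the third input \<open>x\<close>
    must falsify a clause; \<open>neg z\<close> stays true, so that clause does not contain
    it.\<close>
  have crit: "\<exists>C\<in>\<phi>. neg y \<in> C \<and> neg z \<notin> C"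
    if xyz: "L = {x, y, z}" "x \<noteq> y" "x \<noteq> z" "y \<noteq> z" for x y z
  proof -
    obtain \<sigma> where \<sigma>: "models \<sigma> \<phi>" "one_hot L x \<sigma>"
      using amo_encoding_one_hot[OF enc, of x] xyz by auto
    obtain \<tau> where \<tau>: "lit_true \<tau> y"
      "\<And>q. q \<noteq> y \<Longrightarrow> q \<noteq> neg y \<Longrightarrow> lit_true \<tau> q \<longleftrightarrow> lit_true \<sigma> q"
      by (rule assign_literal[of y True \<sigma>]) auto
    have nL: "neg y \<notin> L" using cons[of y] L3 xyz by auto
    have "lit_true \<tau> x" using \<tau>(2)[of x] \<sigma> xyz nL unfolding one_hot_def by auto
    then have "\<not> models \<tau> \<phi>" using amo_encoding_unique[OF enc, of \<tau> x y] \<tau>(1) xyz by auto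
    then obtain C where C: "C \<in> \<phi>" "\<And>q. q \<in> C \<Longrightarrow> \<not> lit_true \<tau> q" unfolding models_def by auto
    obtain q where q: "q \<in> C" "lit_true \<sigma> q" using \<sigma> C unfolding models_def by auto
    then have "neg y \<in> C" using C \<tau> by metis
    moreover have "neg z \<notin> C"
    proof
      assume "neg z \<in> C"
      moreover have "lit_true \<tau> (neg z)"
        using \<tau>(2)[of z] nL xyz \<sigma> unfolding one_hot_def by auto
      ultimately show False using C(2) by blast
    qed
    ultimately show ?thesis using C by blast
  qed
  have fin: "finite \<phi>" by (rule amo_encoding_finite[OF enc])
  show ?thesis
  proof (rule ccontr)
    assume "\<not> 3 \<le> card \<phi>"
    then have "card \<phi> \<le> 2" by simp
    then obtain C D where CD: "\<phi> \<subseteq> {C, D}"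
      using subset_pair[OF fin] by blast
    have crit': "neg y \<in> C \<and> neg z \<notin> C \<or> neg y \<in> D \<and> neg z \<notin> D"
      if "L = {x, y, z}" "x \<noteq> y" "x \<noteq> z" "y \<noteq> z" for x y z
      using crit[OF that] CD by blast
    have perm: "L = {c, a, b}" "L = {b, a, c}" "L = {c, b, a}" "L = {a, b, c}" "L = {b, c, a}" "L = {a, c, b}"
      unfolding L by auto
    show False
      using crit'[OF perm(1)] crit'[OF perm(2)] crit'[OF perm(3)] crit'[OF perm(4)]
        crit'[OF perm(5)] crit'[OF perm(6)] d by metis
  qed
qed


section \<open>Regular encodings as graphs on literals\<close>

definition solution ::
  "'v literal set \<Rightarrow> 'v cnf \<Rightarrow> ('v literal \<Rightarrow> 'v literal) \<Rightarrow> ('v literal \<Rightarrow> 'v literal) \<Rightarrow>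
    'v literal \<Rightarrow> ('v \<Rightarrow> bool) \<Rightarrow> bool" where
  "solution L R l m k \<sigma> \<longleftrightarrow>
     one_hot L k \<sigma> \<and> models \<sigma> R \<and> lit_true \<sigma> (l k) \<and> lit_true \<sigma> (m k)"

text \<open>Each input \<open>i\<close> occurs negatively only in the two binary clauses \<open>i \<longrightarrow> l i\<close> and
  \<open>i \<longrightarrow> m i\<close>, which are kept implicit; \<open>R\<close> holds all other clauses. The inputs are
  thought of as the edges \<open>{l i, m i}\<close> of a graph on literals.\<close>

locale regular_form =
  fixes L :: "'v literal set" and R :: "'v cnf" and l m :: "'v literal \<Rightarrow> 'v literal"
  assumes finite_L: "finite L" and finite_R: "finite R"
    and consistent: "p \<in> L \<Longrightarrow> neg p \<notin> L"
    and l_notin: "i \<in> L \<Longrightarrow> l i \<notin> L" "i \<in> L \<Longrightarrow> neg (l i) \<notin> L"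
    and m_notin: "i \<in> L \<Longrightarrow> m i \<notin> L" "i \<in> L \<Longrightarrow> neg (m i) \<notin> L"
    and l_neq_m: "i \<in> L \<Longrightarrow> l i \<noteq> m i"
    and R_positive: "C \<in> R \<Longrightarrow> p \<in> L \<Longrightarrow> neg p \<notin> C"
    and ex_solution: "k \<in> L \<Longrightarrow> \<exists>\<sigma>. solution L R l m k \<sigma>"
    and unique: "\<lbrakk>models \<sigma> R; \<And>i. i \<in> L \<Longrightarrow> lit_true \<sigma> i \<Longrightarrow> lit_true \<sigma> (l i) \<and> lit_true \<sigma> (m i);
      p \<in> L; q \<in> L; lit_true \<sigma> p; lit_true \<sigma> q\<rbrakk> \<Longrightarrow> p = q"
begin

lemma l_neq_neg_m:
  assumes "i \<in> L"
  shows "l i \<noteq> neg (m i)"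
proof -
  obtain \<sigma> where "solution L R l m i \<sigma>" using ex_solution[OF assms] by blast
  then show ?thesis unfolding solution_def by auto
qed

text \<open>Otherwise \<open>j\<close> could be switched on as well: \<open>R\<close> contains no
  \<open>neg j\<close>, and both implications of \<open>j\<close> would hold, so two inputs would be
  true.\<close>

lemma solution_other_edge:
  assumes \<sigma>: "solution L R l m k \<sigma>" and k: "k \<in> L" and j: "j \<in> L" "j \<noteq> k"
  shows "\<not> (lit_true \<sigma> (l j) \<and> lit_true \<sigma> (m j))"
proof
  assume lm: "lit_true \<sigma> (l j) \<and> lit_true \<sigma> (m j)"
  obtain \<tau> where \<tau>: "lit_true \<tau> j"
    "\<And>q. q \<noteq> j \<Longrightarrow> q \<noteq> neg j \<Longrightarrow> lit_true \<tau> q \<longleftrightarrow> lit_true \<sigma> q"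
    by (rule assign_literal[of j True \<sigma>]) auto
  have "models \<tau> R"
    unfolding models_def
  proof
    fix C assume C: "C \<in> R"
    then obtain q where "q \<in> C" "lit_true \<sigma> q"
      using \<sigma> unfolding solution_def models_def by auto
    then show "\<exists>q\<in>C. lit_true \<tau> q" using R_positive[OF C j(1)] \<tau> by (cases "q = j") auto
  qed
  moreover have same: "lit_true \<tau> q \<longleftrightarrow> lit_true \<sigma> q" if "q \<notin> L" "neg q \<notin> L" for q
    using \<tau>(2)[of q] that j by (metis neg_neg)
  have "lit_true \<tau> (l i) \<and> lit_true \<tau> (m i)" if i: "i \<in> L" "lit_true \<tau> i" for i
  proof -
    have "i = j \<or> i = k"
      using i \<tau>(2)[of i] consistent[OF j(1)] \<sigma> unfolding solution_def one_hot_def by auto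
    then show ?thesis
      using same[of "l i"] same[of "m i"] l_notin[OF i(1)] m_notin[OF i(1)] lm \<sigma>
      unfolding solution_def by auto
  qed
  moreover have "lit_true \<tau> k"
    using \<tau>(2)[of k] j k consistent[OF j(1)] \<sigma> unfolding solution_def one_hot_def by auto
  ultimately show False using unique[of \<tau> j k] j k \<tau>(1) by auto
qed

text \<open>If the inputs incident to \<open>a\<close> are the only ones that may be true and \<open>a\<close> itself is set
  to true, then each such input can be replaced by its other endpoint, and only \<open>R\<close> survives.\<close>

lemma incident_encoding:
  assumes I: "I = {i \<in> L. l i = a \<or> m i = a}" and "I \<noteq> {}"
  shows "\<exists>(L' :: 'v literal set) R'. amo_encoding L' R' \<and> card L' = card I \<and> card R' \<le> card R"
proof -
  \<comment> \<open>\<open>e i\<close> is the endpoint of the edge \<open>i\<close> other than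
    \<open>a\<close>.\<close>
  define e where "e i = (if l i = a then m i else l i)" for i
  have aL: "a \<notin> L" "neg a \<notin> L" using assms l_notin m_notin by auto
  have e: "e i \<noteq> a" "e i \<noteq> neg a" "e i \<notin> L" "neg (e i) \<notin> L" if "i \<in> I" for i
    using that l_neq_m[of i] l_neq_neg_m[of i] l_notin[of i] m_notin[of i]
    unfolding e_def I by auto
  have lm: "lit_true \<sigma> (l i) \<and> lit_true \<sigma> (m i) \<longleftrightarrow> lit_true \<sigma> a \<and> lit_true \<sigma> (e i)" if "i \<in> I" for i \<sigma>
    using that unfolding e_def I by auto
  \<comment> \<open>A solution for \<open>i\<close> makes \<open>a\<close> true, so the other
    endpoint of every further edge at \<open>a\<close> must be false. In particular these endpoints
    are distinct.\<close>
  have other: "\<not> lit_true \<sigma> (e j)" if "i \<in> I" "j \<in> I" "i \<noteq> j" "solution L R l m i \<sigma>" for i j \<sigma>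
    using solution_other_edge[of i \<sigma> j] that lm[of i \<sigma>] lm[of j \<sigma>] unfolding I solution_def by auto
  have inj: "inj_on e I"
  proof (rule inj_onI, rule ccontr)
    fix i j assume ij: "i \<in> I" "j \<in> I" "e i = e j" "i \<noteq> j"
    then obtain \<sigma> where "solution L R l m i \<sigma>" using ex_solution[of i] unfolding I by auto
    then show False using other[OF ij(1,2,4)] ij(3) lm[OF ij(1), of \<sigma>] unfolding solution_def by auto
  qed
  \<comment> \<open>This simplifies \<open>C\<close> after setting \<open>a\<close> to true and all
    inputs outside \<open>I\<close> to false, with each \<open>i\<close> in \<open>I\<close>
    replaced by \<open>e i\<close>.\<close>
  define f where "f C = {q \<in> C. q \<notin> L \<and> q \<noteq> neg a} \<union> e ` (I \<inter> C)" for C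
  define R' where "R' = f ` {C \<in> R. a \<notin> C}"
  have "card R' \<le> card {C \<in> R. a \<notin> C}"
    unfolding R'_def using finite_R by (intro card_image_le) auto
  also have "\<dots> \<le> card R" using finite_R by (intro card_mono) auto
  finally have cardR: "card R' \<le> card R" .
  have "amo_encoding (e ` I) R'"
    unfolding amo_encoding_def
  proof (intro conjI ballI allI impI)
    show "finite R'" unfolding R'_def using finite_R by simp
  next
    fix p assume "p \<in> e ` I"
    then obtain i where i: "i \<in> I" "p = e i" by auto
    then have iL: "i \<in> L" unfolding I by auto
    obtain \<sigma> where \<sigma>: "solution L R l m i \<sigma>" using ex_solution[OF iL] by auto
    then have at: "lit_true \<sigma> a" "lit_true \<sigma> (e i)"
      using lm[OF i(1), of \<sigma>] unfolding solution_def by auto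
    have "models \<sigma> R'"
      unfolding models_def
    proof
      fix C' assume "C' \<in> R'"
      then obtain C where C: "C \<in> R" "a \<notin> C" "C' = f C" unfolding R'_def by auto
      then obtain q where q: "q \<in> C" "lit_true \<sigma> q"
        using \<sigma> unfolding solution_def models_def by auto
      show "\<exists>q\<in>C'. lit_true \<sigma> q"
      proof (cases "q \<in> L")
        case True
        then have "q = i" using \<sigma> q unfolding solution_def one_hot_def by auto
        then show ?thesis using at i q C unfolding f_def by auto
      next
        case False
        then show ?thesis using at q C unfolding f_def by auto
      qed
    qed
    moreover have "one_hot (e ` I) p \<sigma>"
      using other[OF i(1) _ _ \<sigma>] at i unfolding one_hot_def by auto
    ultimately show "\<exists>\<sigma>. models \<sigma> R' \<and> one_hot (e ` I) p \<sigma>" by blast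
  next
    fix \<sigma> x y
    assume \<sigma>: "models \<sigma> R'" and "x \<in> e ` I" "y \<in> e ` I" and xy: "lit_true \<sigma> x" "lit_true \<sigma> y"
    then obtain i j where ij: "i \<in> I" "x = e i" "j \<in> I" "y = e j" by auto
    \<comment> \<open>The same substitution read backwards: \<open>a\<close> is true, an input in
      \<open>I\<close> copies its other endpoint, and all other inputs are false.\<close>
    obtain \<tau> where \<tau>: "\<And>q. q \<in> insert a L \<Longrightarrow> lit_true \<tau> q \<longleftrightarrow> q = a \<or> q \<in> I \<and> lit_true \<sigma> (e q)"
      "\<And>q. q \<notin> insert a L \<Longrightarrow> neg q \<notin> insert a L \<Longrightarrow> lit_true \<tau> q \<longleftrightarrow> lit_true \<sigma> q"
      by (rule override_assignment[of "insert a L" "\<lambda>q. q = a \<or> q \<in> I \<and> lit_true \<sigma> (e q)" \<sigma>])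
        (use aL consistent in auto)
    have e_same: "lit_true \<tau> (e q) \<longleftrightarrow> lit_true \<sigma> (e q)" if "q \<in> I" for q
      using \<tau>(2)[of "e q"] e[OF that] by (auto simp: neg_eq_flip)
    have at: "lit_true \<tau> a" using \<tau>(1)[of a] by simp
    have IL: "lit_true \<tau> q \<longleftrightarrow> q \<in> I \<and> lit_true \<sigma> (e q)" if "q \<in> L" for q
      using \<tau>(1)[of q] that aL by auto
    have "models \<tau> R"
      unfolding models_def
    proof
      fix C assume C: "C \<in> R"
      show "\<exists>q\<in>C. lit_true \<tau> q"
      proof (cases "a \<in> C")
        case True
        then show ?thesis using at by blast
      next
        case False
        then have "f C \<in> R'" using C unfolding R'_def by auto
        then obtain q where q: "q \<in> f C" "lit_true \<sigma> q" using \<sigma> unfolding models_def by auto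
        show ?thesis
        proof (cases "q \<in> e ` (I \<inter> C)")
          case True
          then obtain i where "i \<in> I" "i \<in> C" "q = e i" by auto
          then have "lit_true \<tau> i" using IL[of i] q unfolding I by auto
          then show ?thesis using \<open>i \<in> C\<close> by blast
        next
          case nin: False
          then have "q \<in> C" "q \<notin> L" "q \<noteq> neg a" using q unfolding f_def by auto
          moreover have "neg q \<notin> L"
            using R_positive[OF C, of "neg q"] \<open>q \<in> C\<close> by auto
          moreover have "q \<noteq> a" using False \<open>q \<in> C\<close> by auto
          ultimately have "lit_true \<tau> q" using \<tau>(2)[of q] q by (auto simp: neg_eq_flip)
          then show ?thesis using \<open>q \<in> C\<close> by blast
        qed
      qed
    qed
    moreover have "lit_true \<tau> (l q) \<and> lit_true \<tau> (m q)" if "q \<in> L" "lit_true \<tau> q" for q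
      using IL[of q] that lm[of q \<tau>] e_same[of q] at by auto
    moreover have "lit_true \<tau> i" "lit_true \<tau> j" "i \<in> L" "j \<in> L"
      using ij xy IL[of i] IL[of j] unfolding I by auto
    ultimately have "i = j" using unique[of \<tau> i j] by blast
    then show "x = y" using ij by simp
  qed
  then show ?thesis using cardR card_image[OF inj] by blast
qed

text \<open>Apart from \<open>k\<close> and the edges at \<open>S\<close>, every edge lies in
  \<open>T\<close> (some endpoint is false and critical) or in \<open>NN\<close> (both endpoints can
  be flipped). The proof shows \<open>card T \<le> card R * d\<close> and
  \<open>2 * card NN \<le> card T\<close>, hence
  \<open>2 * card E \<le> 3 * (card R * d)\<close>.\<close>

lemma card_L_le:
  assumes k: "k \<in> L" and deg: "\<And>a. card {i \<in> L. l i = a \<or> m i = a} \<le> d"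
  shows "2 * card L \<le> 2 + 4 * d + 3 * (card R * d)"
proof -
  \<comment> \<open>Making a literal outside \<open>S\<close> true cannot falsify \<open>l k\<close>
    or \<open>m k\<close>.\<close>
  define S where "S = {neg (l k), neg (m k)}"
  define E where "E = {j \<in> L - {k}. l j \<notin> S \<and> m j \<notin> S}"
  have finE: "finite E" unfolding E_def using finite_L by simp
  have EL: "j \<in> L" "j \<noteq> k" if "j \<in> E" for j using that unfolding E_def by auto
  \<comment> \<open>The number of true endpoints, counted once per edge of \<open>E\<close>.\<close>
  define w :: "('v \<Rightarrow> bool) \<Rightarrow> nat" where
    "w \<sigma> = (\<Sum>j\<in>E. of_bool (lit_true \<sigma> (l j)) + of_bool (lit_true \<sigma> (m j)))" for \<sigma>
  have w_le: "w \<sigma> \<le> 2 * card E" for \<sigma>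
  proof -
    have "w \<sigma> \<le> (\<Sum>j\<in>E. 2)" unfolding w_def by (intro sum_mono) auto
    then show ?thesis by simp
  qed
  obtain \<sigma> where \<sigma>: "solution L R l m k \<sigma>" and max: "\<And>\<tau>. solution L R l m k \<tau> \<Longrightarrow> w \<tau> \<le> w \<sigma>"
  proof -
    obtain s where "solution L R l m k s" using ex_solution[OF k] by blast
    then show ?thesis
      using ex_has_greatest_nat[of "solution L R l m k" s w "Suc (2 * card E)"] w_le that
      by (metis le_SucI less_Suc_eq_le)
  qed
  \<comment> \<open>\<open>crit q\<close> means that making \<open>q\<close> true would falsify a
    clause of \<open>R\<close> whose only true literal is \<open>neg q\<close>.\<close>
  define crit where "crit q \<longleftrightarrow> (\<exists>C\<in>R. neg q \<in> C \<and> (\<forall>t\<in>C. lit_true \<sigma> t \<longrightarrow> t = neg q))" for q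
  define A where "A = {q \<in> l ` E \<union> m ` E. \<not> lit_true \<sigma> q \<and> crit q}"
  define N where "N = {q \<in> l ` E \<union> m ` E. \<not> lit_true \<sigma> q \<and> \<not> crit q}"
  have fin: "finite A" "finite N" unfolding A_def N_def using finE by auto
  have "card A \<le> card R"
  proof -
    have "\<forall>q\<in>A. \<exists>C. C \<in> R \<and> neg q \<in> C \<and> (\<forall>t\<in>C. lit_true \<sigma> t \<longrightarrow> t = neg q)"
      unfolding A_def crit_def by blast
    then obtain c where c: "\<forall>q\<in>A. c q \<in> R \<and> neg q \<in> c q \<and> (\<forall>t\<in>c q. lit_true \<sigma> t \<longrightarrow> t = neg q)"
      by (rule bchoice[THEN exE])
    \<comment> \<open>The only true literal of \<open>c q\<close> is \<open>neg q\<close>, so the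
      clause determines \<open>q\<close>.\<close>
    have "inj_on c A"
    proof (rule inj_onI)
      fix x y assume xy: "x \<in> A" "y \<in> A" "c x = c y"
      then have "lit_true \<sigma> (neg x)" "neg x \<in> c y" using c unfolding A_def by auto
      then have "neg x = neg y" using c xy by blast
      then show "x = y" by simp
    qed
    then show ?thesis using c finite_R by (intro card_inj_on_le[of c]) auto
  qed
  have flip: "\<exists>\<tau>. solution L R l m k \<tau> \<and> lit_true \<tau> q \<and>
      (\<forall>t. t \<noteq> q \<longrightarrow> t \<noteq> neg q \<longrightarrow> (lit_true \<tau> t \<longleftrightarrow> lit_true \<sigma> t))" if q: "q \<in> N" for q
  proof -
    obtain \<tau> where \<tau>: "lit_true \<tau> q"
      "\<And>t. t \<noteq> q \<Longrightarrow> t \<noteq> neg q \<Longrightarrow> lit_true \<tau> t \<longleftrightarrow> lit_true \<sigma> t"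
      by (rule assign_literal[of q True \<sigma>]) auto
    have qf: "\<not> lit_true \<sigma> q" "\<not> crit q" using q unfolding N_def by auto
    have qL: "q \<notin> L" "neg q \<notin> L" and qS: "q \<notin> S"
      using q l_notin m_notin unfolding N_def E_def by auto
    have "lit_true \<tau> t \<longleftrightarrow> lit_true \<sigma> t" if "t \<in> L" for t
      using \<tau>(2)[of t] qL that by auto
    then have "one_hot L k \<tau>"
      using \<sigma> unfolding solution_def one_hot_def by auto
    moreover have "models \<tau> R"
      unfolding models_def
    proof
      fix C assume C: "C \<in> R"
      then obtain t0 where "t0 \<in> C" "lit_true \<sigma> t0" using \<sigma> unfolding solution_def models_def by auto
      then obtain t where "t \<in> C" "lit_true \<sigma> t" "t \<noteq> neg q" using qf(2) C unfolding crit_def by blast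
      then show "\<exists>t\<in>C. lit_true \<tau> t" using \<tau>(2)[of t] qf by auto
    qed
    moreover have "lit_true \<tau> t" if "t \<in> {l k, m k}" for t
    proof -
      have "lit_true \<sigma> t" using that \<sigma> unfolding solution_def by auto
      moreover have "t \<noteq> neg q" using that qS unfolding S_def by (auto simp: neg_eq_flip[symmetric])
      ultimately show ?thesis using \<tau>(2)[of t] qf by auto
    qed
    ultimately have "solution L R l m k \<tau>" unfolding solution_def by auto
    then show ?thesis using \<tau> by blast
  qed
  define deg' :: "'v literal \<Rightarrow> nat" where
    "deg' q = (\<Sum>j\<in>E. of_bool (l j = q) + of_bool (m j = q))" for q
  \<comment> \<open>Making \<open>q\<close> true gains \<open>deg' q\<close> true endpoints and
    loses \<open>deg' (neg q)\<close>; by maximality of \<open>w \<sigma>\<close> this is no net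
    gain.\<close>
  have deg'_le: "deg' q \<le> deg' (neg q)" if q: "q \<in> N" for q
  proof -
    obtain \<tau> where \<tau>: "solution L R l m k \<tau>" "lit_true \<tau> q"
      "\<And>t. t \<noteq> q \<Longrightarrow> t \<noteq> neg q \<Longrightarrow> lit_true \<tau> t \<longleftrightarrow> lit_true \<sigma> t"
      using flip[OF q] by blast
    have qf: "\<not> lit_true \<sigma> q" using q unfolding N_def by auto
    have pt: "of_bool (lit_true \<tau> t) + of_bool (t = neg q) =
        (of_bool (lit_true \<sigma> t) + of_bool (t = q) :: nat)" for t
      using \<tau>(2) \<tau>(3)[of t] qf by (cases "t = q"; cases "t = neg q") auto
    have "w \<tau> + deg' (neg q) = (\<Sum>j\<in>E. (of_bool (lit_true \<tau> (l j)) + of_bool (l j = neg q))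
        + (of_bool (lit_true \<tau> (m j)) + of_bool (m j = neg q)))"
      unfolding w_def deg'_def sum.distrib[symmetric] by (intro sum.cong) auto
    also have "\<dots> = w \<sigma> + deg' q"
      unfolding w_def deg'_def pt sum.distrib[symmetric] by (intro sum.cong) auto
    finally show ?thesis using max[OF \<tau>(1)] by linarith
  qed
  have edge: "\<not> lit_true \<sigma> (l j) \<or> \<not> lit_true \<sigma> (m j)" if "j \<in> E" for j
    using solution_other_edge[OF \<sigma> k] EL[OF that] by blast
  \<comment> \<open>After flipping a flippable endpoint the assignment is still a solution, so the
    other endpoint, which the flip does not touch, is false.\<close>
  have N_edge: "(l j \<in> N \<longrightarrow> \<not> lit_true \<sigma> (m j)) \<and> (m j \<in> N \<longrightarrow> \<not> lit_true \<sigma> (l j))" if j: "j \<in> E" for j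
  proof -
    have aux: "\<not> lit_true \<sigma> t"
      if q: "q \<in> N" and qt: "{q, t} = {l j, m j}" for q t
    proof -
      obtain \<tau> where \<tau>: "solution L R l m k \<tau>" "lit_true \<tau> q"
        "\<And>t. t \<noteq> q \<Longrightarrow> t \<noteq> neg q \<Longrightarrow> lit_true \<tau> t \<longleftrightarrow> lit_true \<sigma> t"
        using flip[OF q] by blast
      have "\<not> (lit_true \<tau> q \<and> lit_true \<tau> t)"
        using solution_other_edge[OF \<tau>(1) k EL[OF j]] qt by (auto simp: doubleton_eq_iff)
      moreover have "t \<noteq> q" "t \<noteq> neg q"
        using l_neq_m[OF EL(1)[OF j]] l_neq_neg_m[OF EL(1)[OF j]] qt
        by (auto simp: doubleton_eq_iff neg_eq_flip)
      ultimately show ?thesis using \<tau> by auto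
    qed
    show ?thesis using aux[of "l j" "m j"] aux[of "m j" "l j"] by auto
  qed
  have ends: "l j \<in> A \<or> l j \<in> N \<or> lit_true \<sigma> (l j)" "m j \<in> A \<or> m j \<in> N \<or> lit_true \<sigma> (m j)"
    if "j \<in> E" for j
    using that unfolding A_def N_def by auto
  have N_false: "\<not> lit_true \<sigma> q" if "q \<in> N" for q using that unfolding N_def by auto
  define T where "T = {j \<in> E. l j \<in> A \<or> m j \<in> A}"
  define NN where "NN = {j \<in> E. l j \<in> N \<and> m j \<in> N}"
  have finT: "finite T" "finite NN" unfolding T_def NN_def using finE by auto
  \<comment> \<open>Every edge has a false endpoint. If it is not critical, it is in
    \<open>N\<close>, so the other endpoint is false too and lies in \<open>A\<close> or
    \<open>N\<close>.\<close>
  have "E \<subseteq> T \<union> NN"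
    using edge N_edge ends unfolding T_def NN_def by blast
  then have "card E \<le> card (T \<union> NN)" using finT by (intro card_mono) auto
  then have E_le: "card E \<le> card T + card NN" using card_Un_le[of T NN] by linarith
  \<comment> \<open>Double counting: the incidences of edges with \<open>N\<close> are compared, via
    \<open>deg'_le\<close>, with the incidences with the negations of \<open>N\<close>.\<close>
  have "2 * card NN = (\<Sum>j\<in>NN. 2)" by simp
  also have "\<dots> \<le> (\<Sum>j\<in>NN. of_bool (l j \<in> N) + of_bool (m j \<in> N))"
    unfolding NN_def by (intro sum_mono) auto
  also have "\<dots> \<le> (\<Sum>j\<in>E. of_bool (l j \<in> N) + of_bool (m j \<in> N))"
    unfolding NN_def using finE by (intro sum_mono2) auto
  also have "\<dots> = (\<Sum>j\<in>E. \<Sum>q\<in>N. of_bool (l j = q) + of_bool (m j = q))"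
    using fin(2) by (intro sum.cong refl) (simp add: sum.distrib of_bool_def sum.delta')
  also have "\<dots> = (\<Sum>q\<in>N. deg' q)" unfolding deg'_def by (rule sum.swap)
  also have "\<dots> \<le> (\<Sum>q\<in>N. deg' (neg q))" by (intro sum_mono deg'_le)
  also have "\<dots> = (\<Sum>j\<in>E. \<Sum>q\<in>N. of_bool (l j = neg q) + of_bool (m j = neg q))"
    unfolding deg'_def by (rule sum.swap)
  also have "\<dots> = (\<Sum>j\<in>E. of_bool (neg (l j) \<in> N) + of_bool (neg (m j) \<in> N))"
  proof (intro sum.cong refl)
    fix j
    have eq: "x = neg q \<longleftrightarrow> neg x = q" for x q :: "'v literal" by (metis neg_neg)
    show "(\<Sum>q\<in>N. of_bool (l j = neg q) + of_bool (m j = neg q)) =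
      (of_bool (neg (l j) \<in> N) + of_bool (neg (m j) \<in> N) :: nat)"
      unfolding eq using fin(2) by (simp add: sum.distrib of_bool_def sum.delta')
  qed
  \<comment> \<open>An endpoint whose negation is in \<open>N\<close> is true. The other endpoint is
    then false and, by \<open>N_edge\<close>, not in \<open>N\<close>, so it is in \<open>A\<close>;
    at most one endpoint of an edge is true.\<close>
  also have "\<dots> \<le> (\<Sum>j\<in>E. of_bool (l j \<in> A \<or> m j \<in> A))"
  proof (rule sum_mono)
    fix j assume j: "j \<in> E"
    have "l j \<in> A \<or> m j \<in> A" if "neg (l j) \<in> N \<or> neg (m j) \<in> N"
      using that N_false[of "neg (l j)"] N_false[of "neg (m j)"] edge[OF j] N_edge[OF j] ends[OF j]
      by auto
    moreover have "\<not> (neg (l j) \<in> N \<and> neg (m j) \<in> N)"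
      using N_false[of "neg (l j)"] N_false[of "neg (m j)"] edge[OF j] by auto
    ultimately show "of_bool (neg (l j) \<in> N) + of_bool (neg (m j) \<in> N) \<le>
        (of_bool (l j \<in> A \<or> m j \<in> A) :: nat)"
      by auto
  qed
  also have "\<dots> = card T" unfolding T_def using finE by (simp add: sum.If_cases of_bool_def Int_def)
  finally have NN_le: "2 * card NN \<le> card T" .
  have "T \<subseteq> (\<Union>q\<in>A. {i \<in> L. l i = q \<or> m i = q})" unfolding T_def E_def by auto
  then have "card T \<le> card (\<Union>q\<in>A. {i \<in> L. l i = q \<or> m i = q})"
    using fin(1) finite_L by (intro card_mono) auto
  also have "\<dots> \<le> (\<Sum>q\<in>A. card {i \<in> L. l i = q \<or> m i = q})" using fin(1) by (rule card_UN_le)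
  also have "\<dots> \<le> (\<Sum>q\<in>A. d)" by (intro sum_mono deg)
  also have "\<dots> \<le> card R * d" using \<open>card A \<le> card R\<close> by simp
  finally have T_le: "card T \<le> card R * d" .
  let ?D = "\<lambda>a. {i \<in> L. l i = a \<or> m i = a}"
  have "L \<subseteq> insert k (?D (neg (l k)) \<union> ?D (neg (m k)) \<union> E)" unfolding E_def S_def by auto
  then have "card L \<le> card (insert k (?D (neg (l k)) \<union> ?D (neg (m k)) \<union> E))"
    using finite_L finE by (intro card_mono) auto
  also have "\<dots> \<le> Suc (card (?D (neg (l k)) \<union> ?D (neg (m k)) \<union> E))" by (rule card_insert_le_m1) auto
  also have "\<dots> \<le> Suc (card (?D (neg (l k))) + card (?D (neg (m k))) + card E)"
    by (meson Suc_le_mono add_le_mono1 card_Un_le le_trans)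
  also have "\<dots> \<le> Suc (d + d + card E)" using deg[of "neg (l k)"] deg[of "neg (m k)"] by simp
  finally have "card L \<le> 1 + 2 * d + card E" by simp
  then show ?thesis using E_le NN_le T_le by linarith
qed

end

section \<open>Extracting the regular form from a minimal encoding\<close>

lemma regular_form_exists:
  fixes L :: "'v literal set"
  assumes enc: "amo_encoding L \<phi>" and L3: "card L \<ge> 3"
    and occ: "\<And>p. p \<in> L \<Longrightarrow> card (neg_occ \<phi> p) = 2"
    and disj: "\<And>p k C. \<lbrakk>p \<in> L; k \<in> L; p \<noteq> k; C \<in> \<phi>; neg p \<in> C\<rbrakk> \<Longrightarrow> neg k \<notin> C"
    and minimal: "\<not> (\<exists>(L' :: 'v literal set) \<phi>'.
      amo_encoding L' \<phi>' \<and> card L' = card L \<and> card \<phi>' < card \<phi>)"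
  shows "\<exists>R l m. regular_form L R l m \<and> card \<phi> = 2 * card L + card R"
proof -
  have finL: "finite L" using L3 by (metis card.infinite not_numeral_le_zero)
  have fin: "finite \<phi>" by (rule amo_encoding_finite[OF enc])
  have cons: "neg p \<notin> L" if "p \<in> L" for p by (rule amo_encoding_consistent[OF enc L3 that])
  have no_taut: "p \<notin> C" if "C \<in> \<phi>" "neg p \<in> C" for p C
    using remove_tautology[OF enc that(1) _ that(2)] minimal by blast
  define U where "U = (\<Union>p\<in>L. neg_occ \<phi> p)"
  define R where "R = \<phi> - U"
  have "card U = (\<Sum>p\<in>L. card (neg_occ \<phi> p))"
    unfolding U_def using finL fin disj by (intro card_UN_disjoint) auto
  also have "\<dots> = 2 * card L" using occ by simp
  finally have "card U = 2 * card L" .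
  moreover have "U \<subseteq> \<phi>" unfolding U_def by auto
  ultimately have card\<phi>: "card \<phi> = 2 * card L + card R"
    unfolding R_def using fin by (metis card_Diff_subset card_mono finite_subset le_add_diff_inverse)
  \<comment> \<open>For each \<open>i\<close>, \<open>x\<close> and \<open>y\<close> are true
    literals of its two clauses in one common model of \<open>i\<close>. Shrinking the clauses to
    \<open>neg i\<close> with \<open>x\<close> or \<open>y\<close> strengthens them, so uniqueness
    survives, while that model remains a solution.\<close>
  define P where "P i x y \<longleftrightarrow> (\<exists>\<sigma>. models \<sigma> \<phi> \<and> one_hot L i \<sigma> \<and> lit_true \<sigma> x \<and> lit_true \<sigma> y) \<and>
      x \<noteq> y \<and> x \<notin> L \<and> neg x \<notin> L \<and> y \<notin> L \<and> neg y \<notin> L \<and>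
      (\<forall>C\<in>neg_occ \<phi> i. x \<in> C \<or> y \<in> C)" for i x y
  have "\<exists>x y. P i x y" if i: "i \<in> L" for i
  proof -
    obtain D E where DE: "neg_occ \<phi> i = {D, E}" "D \<noteq> E"
      using occ[OF i] by (auto simp: card_2_iff)
    then have D: "D \<in> \<phi>" "neg i \<in> D" and E: "E \<in> \<phi>" "neg i \<in> E" by auto
    obtain \<sigma> where \<sigma>: "models \<sigma> \<phi>" "one_hot L i \<sigma>"
      using amo_encoding_one_hot[OF enc i] by blast
    obtain x where x: "x \<in> D" "lit_true \<sigma> x" using \<sigma>(1) D(1) unfolding models_def by auto
    obtain y where y: "y \<in> E" "lit_true \<sigma> y" using \<sigma>(1) E(1) unfolding models_def by auto
    have it: "lit_true \<sigma> i" using \<sigma> i unfolding one_hot_def by auto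
    \<comment> \<open>A true input would be \<open>i\<close> itself, making \<open>C\<close> a
      tautology; a negated input other than \<open>i\<close> would make \<open>C\<close> a shared
      clause.\<close>
    have notin: "z \<notin> L \<and> neg z \<notin> L" if z: "z \<in> C" "lit_true \<sigma> z" and C: "C \<in> \<phi>" "neg i \<in> C" for z C
    proof
      show "z \<notin> L"
        using \<sigma> z no_taut[OF C] unfolding one_hot_def by auto
      show "neg z \<notin> L"
      proof
        assume zL: "neg z \<in> L"
        then have "neg z \<noteq> i" using \<sigma> z it unfolding one_hot_def by auto
        then show False using disj[OF i zL _ C] z by auto
      qed
    qed
    \<comment> \<open>A literal common to both clauses could be substituted for \<open>i\<close>,
      against minimality.\<close>
    have "x \<noteq> y"
    proof
      assume xy: "x = y"
      have "x \<noteq> i" "x \<noteq> neg i" using notin[OF x D] i by auto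
      then show False
        using substitute_common_literal[OF enc L3 i _ _ _ _ \<sigma> x(2)] DE x y xy minimal by auto
    qed
    then have "P i x y"
      unfolding P_def using \<sigma> x y notin[OF x D] notin[OF y E] DE by auto
    then show ?thesis by blast
  qed
  then have "\<forall>i\<in>L. \<exists>xy. P i (fst xy) (snd xy)" by (metis fst_conv snd_conv)
  then obtain h where h: "\<And>i. i \<in> L \<Longrightarrow> P i (fst (h i)) (snd (h i))"
    using bchoice[of L "\<lambda>i xy. P i (fst xy) (snd xy)"] by blast
  define l where "l i = fst (h i)" for i
  define m where "m i = snd (h i)" for i
  have P: "P i (l i) (m i)" if "i \<in> L" for i using h[OF that] unfolding l_def m_def .
  have "regular_form L R l m"
  proof
    show "finite L" "finite R" using finL fin unfolding R_def by auto
    show "neg p \<notin> L" if "p \<in> L" for p using cons[OF that] .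
    show "l i \<notin> L" "neg (l i) \<notin> L" "m i \<notin> L" "neg (m i) \<notin> L" "l i \<noteq> m i" if "i \<in> L" for i
      using P[OF that] unfolding P_def by auto
    show "neg p \<notin> C" if "C \<in> R" "p \<in> L" for C p
      using that unfolding R_def U_def by auto
    show "\<exists>\<sigma>. solution L R l m k \<sigma>" if "k \<in> L" for k
      using P[OF that] unfolding P_def solution_def models_def R_def by auto
    show "p = q"
      if \<sigma>: "models \<sigma> R" "\<And>i. i \<in> L \<Longrightarrow> lit_true \<sigma> i \<Longrightarrow> lit_true \<sigma> (l i) \<and> lit_true \<sigma> (m i)"
        and pq: "p \<in> L" "q \<in> L" "lit_true \<sigma> p" "lit_true \<sigma> q" for \<sigma> p q
    proof (rule amo_encoding_unique[OF enc _ pq])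
      show "models \<sigma> \<phi>"
        unfolding models_def
      proof
        fix C assume C: "C \<in> \<phi>"
        show "\<exists>q\<in>C. lit_true \<sigma> q"
        proof (cases "C \<in> R")
          case True
          then show ?thesis using \<sigma>(1) unfolding models_def by blast
        next
          case False
          then obtain i where i: "i \<in> L" "neg i \<in> C" using C unfolding R_def U_def by auto
          then have "l i \<in> C \<or> m i \<in> C" using P[OF i(1)] C unfolding P_def by auto
          moreover have "lit_true \<sigma> (neg i) \<or> lit_true \<sigma> (l i) \<and> lit_true \<sigma> (m i)"
            using \<sigma>(2)[OF i(1)] by auto
          ultimately show ?thesis using i(2) by blast
        qed
      qed
    qed
  qed
  then show ?thesis using card\<phi> by blast
qed

section \<open>The numerical bound and the induction\<close>

text \<open>The existential says \<open>c \<ge> 2 * n + sqrt (n + 1) - 2\<close>; the bound \<open>3 * n - 7\<close> is what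
  losing three clauses per input yields for small \<open>n\<close>, and the two cross at \<open>n = 8\<close>.\<close>

definition amo_bound :: "nat \<Rightarrow> nat \<Rightarrow> bool" where
  "amo_bound n c \<longleftrightarrow>
     2 * n \<le> c + 3 \<and> (3 * n \<le> c + 7 \<or> (\<exists>u. 2 * n + u \<le> c + 2 \<and> n + 1 \<le> u * u))"

lemma amo_bound_mono: "amo_bound n c \<Longrightarrow> c \<le> c' \<Longrightarrow> amo_bound n c'"
  unfolding amo_bound_def by (meson add_le_mono1 le_trans)

text \<open>Two of the three new clauses pay for the new input, the third for raising
  \<open>u\<close> by one.\<close>

lemma amo_bound_step:
  assumes "amo_bound n c" "c + 3 \<le> c'"
  shows "amo_bound (Suc n) c'"
proof (cases "3 * n \<le> c + 7")
  case True
  then show ?thesis using assms unfolding amo_bound_def by auto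
next
  case False
  then obtain u where "2 * n + u \<le> c + 2" "n + 1 \<le> u * u"
    using assms unfolding amo_bound_def by auto
  then have "2 * Suc n + Suc u \<le> c' + 2" "Suc n + 1 \<le> Suc u * Suc u"
    using assms(2) by auto
  moreover have "2 * Suc n \<le> c' + 3" using assms unfolding amo_bound_def by auto
  ultimately show ?thesis unfolding amo_bound_def by blast
qed

text \<open>For \<open>r \<ge> 1\<close> and \<open>2 * d \<le> r + 3\<close>, the right-hand side
  of the second hypothesis is at most quadratic in \<open>r\<close>, small enough for
  \<open>u = r + 2\<close>. Otherwise \<open>d \<le> 2\<close> and \<open>r \<le> 1\<close>, and the
  constants give \<open>n \<le> r + 7\<close>.\<close>

lemma amo_bound_regular:
  assumes d: "d \<le> 2 \<or> 2 * d \<le> r + 3" and n: "2 * n \<le> 2 + 4 * d + 3 * (r * d)"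
  shows "amo_bound n (2 * n + r)"
proof (cases "2 * d \<le> r + 3 \<and> r \<ge> 1")
  case True
  then have "r * (2 * d) \<le> r * (r + 3)" by (intro mult_le_mono2) auto
  moreover have "r \<le> r * r" using True by simp
  ultimately have "n + 1 \<le> (r + 2) * (r + 2)"
    using n True by (simp add: algebra_simps)
  then show ?thesis unfolding amo_bound_def by auto
next
  case False
  then have "d \<le> 2" "r \<le> 1" using d by auto
  then have "r * d \<le> 2 * r" by simp
  then have "n \<le> r + 7" using n \<open>d \<le> 2\<close> \<open>r \<le> 1\<close> by linarith
  then show ?thesis unfolding amo_bound_def by auto
qed

text \<open>The induction is on clauses rather than inputs, since substitution keeps the number of
  inputs.\<close>

lemma amo_encoding_bound:
  assumes "amo_encoding L \<phi>" "card L \<ge> 3"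
  shows "amo_bound (card L) (card \<phi>)"
  using assms
proof (induction "card \<phi>" arbitrary: L \<phi> rule: less_induct)
  case less
  note enc = less.prems(1) and L3 = less.prems(2)
  show ?case
  proof (cases "card L = 3")
    case True
    then show ?thesis using three_inputs[OF enc True] unfolding amo_bound_def by auto
  next
    case False
    then have L4: "card L \<ge> 4" using L3 by simp
    show ?thesis
    proof (cases "\<exists>(L' :: 'a literal set) \<phi>'. amo_encoding L' \<phi>' \<and> card L' = card L - 1 \<and> card \<phi>' + 3 \<le> card \<phi>")
      case True
      then obtain L' :: "'a literal set" and \<phi>' where
        *: "amo_encoding L' \<phi>'" "card L' = card L - 1" "card \<phi>' + 3 \<le> card \<phi>" by blast
      then have "amo_bound (card L') (card \<phi>')" using less.hyps[of \<phi>' L'] L4 by auto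
      then have "amo_bound (Suc (card L')) (card \<phi>)" using *(3) by (rule amo_bound_step)
      then show ?thesis using *(2) L4 by simp
    next
      case no_step: False
      show ?thesis
      proof (cases "\<exists>(L' :: 'a literal set) \<phi>'. amo_encoding L' \<phi>' \<and> card L' = card L \<and> card \<phi>' < card \<phi>")
        case True
        then obtain L' :: "'a literal set" and \<phi>' where
          *: "amo_encoding L' \<phi>'" "card L' = card L" "card \<phi>' < card \<phi>" by blast
        then have "amo_bound (card L) (card \<phi>')" using less.hyps[of \<phi>' L'] L3 by auto
        then show ?thesis using *(3) by (auto elim: amo_bound_mono)
      next
        case minimal: False
        have occ: "card (neg_occ \<phi> p) = 2" if "p \<in> L" for p
        proof -
          have "\<not> card (neg_occ \<phi> p) \<le> 1"
            using few_negative_occurrences[OF enc L3 that] minimal by blast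
          moreover have "\<not> 3 \<le> card (neg_occ \<phi> p)"
            using many_negative_occurrences[OF enc L3 that] no_step by blast
          ultimately show ?thesis by linarith
        qed
        have disj: "neg k \<notin> C" if "p \<in> L" "k \<in> L" "p \<noteq> k" "C \<in> \<phi>" "neg p \<in> C" for p k C
          using shared_clause[OF enc L4 that(1-3) occ occ that(4,5)] that no_step by blast
        obtain R l m where reg: "regular_form L R l m" and card\<phi>: "card \<phi> = 2 * card L + card R"
        proof -
          have "\<exists>R l m. regular_form L R l m \<and> card \<phi> = 2 * card L + card R"
            by (rule regular_form_exists[OF enc L3]) (fact occ disj minimal)+
          then show ?thesis using that by blast
        qed
        \<comment> \<open>The induction hypothesis needs at least three incident edges; the maximum
          with \<open>2\<close> covers smaller degrees.\<close>
        define d where "d = max 2 ((card R + 3) div 2)"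
        have "card {i \<in> L. l i = a \<or> m i = a} \<le> d" (is "card ?I \<le> d") for a
        proof (cases "card ?I \<ge> 3")
          case True
          then have "?I \<noteq> {}" by (metis card.empty not_numeral_le_zero)
          then obtain L' :: "'a literal set" and R' where
            *: "amo_encoding L' R'" "card L' = card ?I" "card R' \<le> card R"
            using regular_form.incident_encoding[OF reg refl] by blast
          moreover have "card R' < card \<phi>" using * card\<phi> L3 by linarith
          ultimately have "amo_bound (card ?I) (card R')" using less.hyps[of R' L'] True by auto
          \<comment> \<open>The linear conjunct of \<open>amo_bound\<close>, applied to
            \<open>R'\<close>, becomes the degree bound.\<close>
          then have "2 * card ?I \<le> card R + 3" using *(3) unfolding amo_bound_def by linarith
          then show ?thesis unfolding d_def by linarith
        next
          case False
          then show ?thesis unfolding d_def by linarith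
        qed
        moreover obtain k where "k \<in> L" by (rule ex_third[OF L3])
        ultimately have "2 * card L \<le> 2 + 4 * d + 3 * (card R * d)"
          using regular_form.card_L_le[OF reg] by blast
        moreover have "d \<le> 2 \<or> 2 * d \<le> card R + 3" unfolding d_def by linarith
        ultimately show ?thesis unfolding card\<phi> by (intro amo_bound_regular)
      qed
    qed
  qed
qed

section \<open>From CNF encodings to the real-valued bound\<close>

lemma amo_encoding_of_encodes:
  assumes "encodes X Y \<phi> AtMostOne"
  shows "amo_encoding (Pos ` set X) \<phi>"
proof -
  have dist: "distinct X" and fin: "finite \<phi>"
    and sat: "\<And>\<tau>. dom \<tau> = set X \<Longrightarrow>
      AtMostOne (map (\<lambda>x. the (\<tau> x)) X) \<longleftrightarrow> satisfiable (restrict_cnf \<phi> \<tau>)"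
    using assms unfolding encodes_def is_cnf_over_def by auto
  show ?thesis
    unfolding amo_encoding_def
  proof (intro conjI ballI allI impI)
    show "finite \<phi>" by (rule fin)
  next
    fix p assume "p \<in> Pos ` set X"
    then obtain x where x: "x \<in> set X" "p = Pos x" by auto
    define \<tau> where "\<tau> v = (if v \<in> set X then Some (v = x) else None)" for v
    have "{i. i < length X \<and> X ! i = x} \<subseteq> {i}" if "i < length X" "X ! i = x" for i
      using that dist by (auto simp: nth_eq_iff_index_eq)
    moreover obtain i where "i < length X" "X ! i = x" using x by (auto simp: in_set_conv_nth)
    ultimately have "card {i. i < length X \<and> X ! i = x} \<le> card {i}" by (intro card_mono) auto
    moreover have "{i. i < length X \<and> map (\<lambda>x. the (\<tau> x)) X ! i} = {i. i < length X \<and> X ! i = x}"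
      unfolding \<tau>_def by auto
    ultimately have "AtMostOne (map (\<lambda>x. the (\<tau> x)) X)"
      unfolding AtMostOne_def by simp
    moreover have "dom \<tau> = set X" unfolding \<tau>_def by (auto split: if_splits)
    ultimately obtain \<sigma> where \<sigma>: "\<forall>C\<in>restrict_cnf \<phi> \<tau>. \<exists>l\<in>C. lit_true \<sigma> l"
      using sat unfolding satisfiable_def by blast
    \<comment> \<open>Gluing the input values to a satisfying assignment of the restriction gives a
      model of \<open>\<phi>\<close>.\<close>
    define \<rho> where "\<rho> v = (case \<tau> v of None \<Rightarrow> \<sigma> v | Some b \<Rightarrow> b)" for v
    have "models \<rho> \<phi>"
      unfolding models_def
    proof
      fix C assume C: "C \<in> \<phi>"
      have sat_true: "lit_true \<rho> l" if "lit_satisfied \<tau> l" for l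
        using that unfolding \<rho>_def by (cases l) auto
      have unset_true: "lit_true \<rho> l" if "lit_true \<sigma> l" "\<not> lit_falsified \<tau> l" for l
        using that unfolding \<rho>_def by (cases l) (auto split: option.split)
      show "\<exists>q\<in>C. lit_true \<rho> q"
      proof (cases "clause_satisfied \<tau> C")
        case True
        then show ?thesis using sat_true unfolding clause_satisfied_def by blast
      next
        case False
        then have "{l \<in> C. \<not> lit_falsified \<tau> l} \<in> restrict_cnf \<phi> \<tau>"
          using C unfolding restrict_cnf_def by auto
        then obtain l where "l \<in> C" "\<not> lit_falsified \<tau> l" "lit_true \<sigma> l" using \<sigma> by auto
        then show ?thesis using unset_true by auto
      qed
    qed
    moreover have "one_hot (Pos ` set X) p \<rho>"
      unfolding one_hot_def \<rho>_def \<tau>_def x(2) by auto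
    ultimately show "\<exists>\<sigma>. models \<sigma> \<phi> \<and> one_hot (Pos ` set X) p \<sigma>" by blast
  next
    fix \<sigma> p q
    assume \<sigma>: "models \<sigma> \<phi>" and "p \<in> Pos ` set X" "q \<in> Pos ` set X"
      and pq: "lit_true \<sigma> p" "lit_true \<sigma> q"
    then obtain i j where i: "i < length X" "p = Pos (X ! i)" and j: "j < length X" "q = Pos (X ! j)"
      by (auto simp: in_set_conv_nth)
    define \<tau> where "\<tau> v = (if v \<in> set X then Some (\<sigma> v) else None)" for v
    have "dom \<tau> = set X" unfolding \<tau>_def by (auto split: if_splits)
    \<comment> \<open>A model of \<open>\<phi>\<close> satisfies its own restriction, since none of
      its true literals is falsified by \<open>\<tau>\<close>.\<close>
    moreover have "satisfiable (restrict_cnf \<phi> \<tau>)"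
      unfolding satisfiable_def
    proof (intro exI ballI)
      fix C' assume "C' \<in> restrict_cnf \<phi> \<tau>"
      then obtain C where C: "C \<in> \<phi>" "C' = {l \<in> C. \<not> lit_falsified \<tau> l}"
        unfolding restrict_cnf_def by auto
      obtain l where "l \<in> C" "lit_true \<sigma> l" using \<sigma> C unfolding models_def by blast
      moreover have "\<not> lit_falsified \<tau> l" using \<open>lit_true \<sigma> l\<close> unfolding \<tau>_def by (cases l) auto
      ultimately show "\<exists>l\<in>C'. lit_true \<sigma> l" using C by auto
    qed
    ultimately have "AtMostOne (map (\<lambda>x. the (\<tau> x)) X)" using sat by blast
    then have "card {i. i < length X \<and> map (\<lambda>x. the (\<tau> x)) X ! i} \<le> 1"
      unfolding AtMostOne_def by simp
    moreover have "{i, j} \<subseteq> {i. i < length X \<and> map (\<lambda>x. the (\<tau> x)) X ! i}"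
      using i j pq unfolding \<tau>_def by auto
    then have "card {i, j} \<le> card {i. i < length X \<and> map (\<lambda>x. the (\<tau> x)) X ! i}"
      by (intro card_mono) auto
    ultimately have "card {i, j} \<le> 1" by linarith
    then have "i = j" by (cases "i = j") auto
    then show "p = q" using i j by simp
  qed
qed

theorem theorem2:
  fixes n :: nat and X :: "'v list" and Y :: "'v set" and \<phi> :: "'v cnf"
  assumes "n \<ge> 8"
    and "length X = n"
    and "encodes X Y \<phi> AtMostOne"
  shows "real (cnf_size \<phi>) \<ge> 2 * real n + sqrt (real n + 1) - 2"
proof -
  have "distinct X" using assms(3) unfolding encodes_def by simp
  then have card: "card (Pos ` set X) = n"
    using assms(2) by (simp add: card_image inj_on_def distinct_card)
  then have "amo_bound n (card \<phi>)"
    using amo_encoding_bound[OF amo_encoding_of_encodes[OF assms(3)]] assms(1) by simp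
  then consider "3 * n \<le> card \<phi> + 7" | u where "2 * n + u \<le> card \<phi> + 2" "n + 1 \<le> u * u"
    unfolding amo_bound_def by blast
  then show ?thesis
  proof cases
    case 1
    \<comment> \<open>The product equals \<open>(n - 5)\<^sup>2 - (n + 1)\<close>, which is where
      \<open>n \<ge> 8\<close> is needed to get from \<open>3 * n - 7\<close> to the claimed
      bound.\<close>
    have "0 \<le> (real n - 8) * (real n - 3)" using assms(1) by simp
    then have "real n + 1 \<le> (real n - 5)\<^sup>2" by (simp add: power2_eq_square algebra_simps)
    then have "sqrt (real n + 1) \<le> real n - 5" using assms(1) by (intro real_le_lsqrt) auto
    moreover have "3 * real n \<le> real (card \<phi>) + 7" using 1 by linarith
    ultimately show ?thesis unfolding cnf_size_def by linarith
  next
    case 2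
    have "real n + 1 \<le> (real u)\<^sup>2"
      using 2(2) unfolding power2_eq_square by (metis of_nat_1 of_nat_add of_nat_le_iff of_nat_mult)
    then have "sqrt (real n + 1) \<le> real u" by (intro real_le_lsqrt) auto
    moreover have "2 * real n + real u \<le> real (card \<phi>) + 2" using 2(1) by linarith
    ultimately show ?thesis unfolding cnf_size_def by linarith
  qed
qed

end
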